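(* Let $f$ be an indecomposable finite character on the infinite symmetric inverse semigroup $R_\infty$, let $r\in R_\infty$, and let $r=q_1\cdot q_2\cdots q_k$ be a decomposition of $r$ into a product of independent quasicycles (i.e. quasicycles with ${\rm supp}\,q_i\cap{\rm supp}\,q_j=\emptyset$ for all $i\neq j$). Then $$f(r)=\prod_{j=1}^k f(q_j).$$
   Context: $R_\infty$ is the semigroup (under matrix multiplication) of all infinite 0-1 matrices $[r_{ij}]_{i,j\in\mathbb{N}}$ with at most one entry 1 in each row and each column and such that $r_{nn}=1$ for all sufficiently large $n$. Its involution is transposition, $[r_{ij}]^\star=[r_{ji}]$ (also written $r^*$). The group $\mathfrak{S}_\infty$ of finitely supported permutations of $\mathbb{N}$ is the subgroup of permutation matrices in $R_\infty$. For $r=[r_{mn}]\in R_\infty$, ${\rm supp}\,r$ is the (finite) complement of $\{n\in\mathbb{N}:r_{nn}=1\}$. For a finite $\mathbb{A}\subset\mathbb{N}$, $\epsilon_{\mathbb{A}}\in R_\infty$ is the diagonal matrix whose $i$th diagonal entry is $0$ if $i\in\mathbb{A}$ and $1$ if $i\notin\mathbb{A}$. A quasicycle is an element $q=c\cdot\epsilon_{\mathbb{A}}$, where $c=(n_1\;n_2\;\cdots\;n_k)$ is a cycle in $\mathfrak{S}_\infty$ and $\mathbb{A}\subseteq\{n_1,\ldots,n_k\}$; elements $\epsilon_{\{n\}}$ are also quasicycles (cycle of length one). Every $r\in R_\infty$ is a product of independent quasicycles; the decomposition is in general not unique. An indecomposable finite character on $R_\infty$ is a function $f:R_\infty\to\mathbb{C}$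 that is (1) central: $f(rs)=f(sr)$ for all $r,s$; (2) positive definite: for all $r_1,\ldots,r_n\in R_\infty$ the matrix $[f(r_i^*r_j)]$ is Hermitian and non-negative definite; (3) indecomposable: not a sum of two linearly independent functions satisfying (1) and (2); (4) normalized: $f(e)=1$, where $e$ is the identity. *)

theory Defs
  imports
    Complex_Main
    "HOL-Library.Groups_Big_Fun"
    "HOL-Library.Nonpos_Ints"
    "HOL-Combinatorics.Cycles"
begin

section \<open>The infinite symmetric inverse semigroup\<close>

typedef rinf = "{r :: nat \<Rightarrow> nat \<Rightarrow> int.
    (\<forall>i j. r i j \<in> {0, 1}) \<and>
    (\<forall>i. \<exists>\<^sub>\<le>\<^sub>1 j. r i j = 1) \<and>
    (\<forall>j. \<exists>\<^sub>\<le>\<^sub>1 i. r i j = 1) \<and>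
    (\<exists>N. \<forall>n\<ge>N. r n n = 1)}"
  morphisms entry Abs_rinf
  by (rule exI[of _ "\<lambda>i j. if i = j then 1 else 0"]) (auto simp: Uniq_def)

setup_lifting type_definition_rinf

text \<open>
  The sum below runs over the indices with a nonzero summand. For elements of the
  semigroup there is at most one such index.
\<close>

definition mat_mult :: "(nat \<Rightarrow> nat \<Rightarrow> int) \<Rightarrow> (nat \<Rightarrow> nat \<Rightarrow> int) \<Rightarrow> nat \<Rightarrow> nat \<Rightarrow> int" where
  "mat_mult r s = (\<lambda>i j. Sum_any (\<lambda>k. r i k * s k j))"

lemma mat_mult_zero_row: "(\<And>k. r i k = 0) \<Longrightarrow> mat_mult r s i j = 0"
  by (simp add: mat_mult_def)

lemma mat_mult_unit_row:
  assumes "\<And>l. r i l = (if l = k then 1 else 0)"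
  shows "mat_mult r s i j = s k j"
proof -
  have "(\<lambda>l. r i l * s l j) = (\<lambda>l. if l = k then s l j else 0)"
    by (auto simp: assms)
  then have "mat_mult r s i j = Sum_any (\<lambda>l. if l = k then s l j else 0)"
    unfolding mat_mult_def by (rule arg_cong)
  then show ?thesis by simp
qed

lemma row_cases:
  fixes r :: "nat \<Rightarrow> nat \<Rightarrow> int"
  assumes "\<forall>i j. r i j \<in> {0, 1}" "\<forall>i. \<exists>\<^sub>\<le>\<^sub>1 j. r i j = 1"
  obtains (zero) "\<And>k. r i k = 0" | (unit) k where "\<And>l. r i l = (if l = k then 1 else 0)"
proof (cases "\<exists>k. r i k = 1")
  case True
  then obtain k where k: "r i k = 1" by blast
  have "r i l = (if l = k then 1 else 0)" for l
    using assms k unfolding Uniq_def by (cases "l = k") (auto, blast)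
  then show ?thesis by (rule unit)
next
  case False
  then have "r i k = 0" for k using assms(1) by blast
  then show ?thesis by (rule zero)
qed

lemma mat_mult_eq_1:
  assumes "\<forall>i j. r i j \<in> {0, 1}" "\<forall>i. \<exists>\<^sub>\<le>\<^sub>1 j. r i j = 1"
  shows "mat_mult r s i j = 1 \<longleftrightarrow> (\<exists>k. r i k = 1 \<and> s k j = 1)"
  by (rule row_cases[OF assms, of i])
    (auto simp: mat_mult_zero_row mat_mult_unit_row)

instantiation rinf :: monoid_mult
begin

lift_definition one_rinf :: rinf is "\<lambda>i j. if i = j then 1 else 0"
  by (auto simp: Uniq_def)

lift_definition times_rinf :: "rinf \<Rightarrow> rinf \<Rightarrow> rinf" is mat_mult
proof -
  fix r s :: "nat \<Rightarrow> nat \<Rightarrow> int"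
  assume "(\<forall>i j. r i j \<in> {0, 1}) \<and> (\<forall>i. \<exists>\<^sub>\<le>\<^sub>1 j. r i j = 1) \<and>
          (\<forall>j. \<exists>\<^sub>\<le>\<^sub>1 i. r i j = 1) \<and> (\<exists>N. \<forall>n\<ge>N. r n n = 1)"
     and "(\<forall>i j. s i j \<in> {0, 1}) \<and> (\<forall>i. \<exists>\<^sub>\<le>\<^sub>1 j. s i j = 1) \<and>
          (\<forall>j. \<exists>\<^sub>\<le>\<^sub>1 i. s i j = 1) \<and> (\<exists>N. \<forall>n\<ge>N. s n n = 1)"
  then have r01: "\<forall>i j. r i j \<in> {0, 1}" and rrow: "\<forall>i. \<exists>\<^sub>\<le>\<^sub>1 j. r i j = 1"
    and rcol: "\<forall>j. \<exists>\<^sub>\<le>\<^sub>1 i. r i j = 1" and rfin: "\<exists>N. \<forall>n\<ge>N. r n n = 1"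
    and s01: "\<forall>i j. s i j \<in> {0, 1}" and srow: "\<forall>i. \<exists>\<^sub>\<le>\<^sub>1 j. s i j = 1"
    and scol: "\<forall>j. \<exists>\<^sub>\<le>\<^sub>1 i. s i j = 1" and sfin: "\<exists>N. \<forall>n\<ge>N. s n n = 1"
    by auto
  note eq1 = mat_mult_eq_1[OF r01 rrow]
  have "mat_mult r s i j \<in> {0, 1}" for i j
    by (rule row_cases[OF r01 rrow, of i])
      (use s01 in \<open>simp_all add: mat_mult_zero_row mat_mult_unit_row\<close>)
  moreover have "\<exists>\<^sub>\<le>\<^sub>1 j. mat_mult r s i j = 1" for i
    unfolding eq1 using rrow srow unfolding Uniq_def by metis
  moreover have "\<exists>\<^sub>\<le>\<^sub>1 i. mat_mult r s i j = 1" for j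
    unfolding eq1 using rcol scol unfolding Uniq_def by metis
  moreover have "\<exists>N. \<forall>n\<ge>N. mat_mult r s n n = 1"
  proof -
    obtain M N where "\<forall>n\<ge>M. r n n = 1" "\<forall>n\<ge>N. s n n = 1"
      using rfin sfin by blast
    then have "\<forall>n\<ge>max M N. mat_mult r s n n = 1"
      unfolding eq1 by auto
    then show ?thesis by blast
  qed
  ultimately show "(\<forall>i j. mat_mult r s i j \<in> {0, 1}) \<and>
      (\<forall>i. \<exists>\<^sub>\<le>\<^sub>1 j. mat_mult r s i j = 1) \<and>
      (\<forall>j. \<exists>\<^sub>\<le>\<^sub>1 i. mat_mult r s i j = 1) \<and> (\<exists>N. \<forall>n\<ge>N. mat_mult r s n n = 1)"
    by blast
qed

instance
proof
  fix a b c :: rinf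
  show "a * b * c = a * (b * c)"
  proof (transfer, intro ext)
    fix r s t :: "nat \<Rightarrow> nat \<Rightarrow> int" and i j
    assume "(\<forall>i j. r i j \<in> {0, 1}) \<and> (\<forall>i. \<exists>\<^sub>\<le>\<^sub>1 j. r i j = 1) \<and>
          (\<forall>j. \<exists>\<^sub>\<le>\<^sub>1 i. r i j = 1) \<and> (\<exists>N. \<forall>n\<ge>N. r n n = 1)"
    then have r01: "\<forall>i j. r i j \<in> {0, 1}" and rrow: "\<forall>i. \<exists>\<^sub>\<le>\<^sub>1 j. r i j = 1"
      by auto
    show "mat_mult (mat_mult r s) t i j = mat_mult r (mat_mult s t) i j"
    proof (rule row_cases[OF r01 rrow, of i])
      assume "\<And>k. r i k = 0"
      then show ?thesis by (simp add: mat_mult_zero_row)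
    next
      fix k assume k: "\<And>l. r i l = (if l = k then 1 else 0)"
      have "mat_mult r s i = s k"
        by (rule ext) (rule mat_mult_unit_row[where r = r, OF k])
      then have "mat_mult (mat_mult r s) t i j = mat_mult s t k j"
        by (simp only: mat_mult_def[of _ t])
      also have "\<dots> = mat_mult r (mat_mult s t) i j"
        by (rule mat_mult_unit_row[where r = r, OF k, symmetric])
      finally show ?thesis .
    qed
  qed
  show "1 * a = a"
    by transfer (intro ext mat_mult_unit_row, auto)
  show "a * 1 = a"
  proof (transfer, intro ext)
    fix r :: "nat \<Rightarrow> nat \<Rightarrow> int" and i j
    have "(\<lambda>k. r i k * (if k = j then 1 else 0)) = (\<lambda>k. if k = j then r i k else 0)"
      by auto
    then have "mat_mult r (\<lambda>i j. if i = j then 1 else 0) i j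
        = Sum_any (\<lambda>k. if k = j then r i k else 0)"
      unfolding mat_mult_def by (rule arg_cong)
    then show "mat_mult r (\<lambda>i j. if i = j then 1 else 0) i j = r i j" by simp
  qed
qed

end

lift_definition star :: "rinf \<Rightarrow> rinf" is "\<lambda>r i j. r j i"
  by blast

definition supp :: "rinf \<Rightarrow> nat set" where
  "supp r = - {n. entry r n n = 1}"


section \<open>Quasicycles\<close>

text \<open>Meaningful for finite \<open>A\<close> only.\<close>

definition eps :: "nat set \<Rightarrow> rinf" where
  "eps A = Abs_rinf (\<lambda>i j. if i = j \<and> i \<notin> A then 1 else 0)"

text \<open>
  Meaningful for finitely supported permutations only. Column \<open>j\<close> has its entry \<open>1\<close> in row
  \<open>\<sigma> j\<close>, so that composition corresponds to matrix multiplication.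
\<close>

definition perm_rinf :: "(nat \<Rightarrow> nat) \<Rightarrow> rinf" where
  "perm_rinf \<sigma> = Abs_rinf (\<lambda>i j. if i = \<sigma> j then 1 else 0)"

lemma entry_eps:
  assumes "finite A"
  shows "entry (eps A) i j = (if i = j \<and> i \<notin> A then 1 else 0)"
proof -
  obtain N where "\<forall>n\<in>A. n < N"
    using assms finite_nat_set_iff_bounded by blast
  then show ?thesis
    unfolding eps_def by (subst Abs_rinf_inverse) (auto simp: Uniq_def intro!: exI[of _ N])
qed

lemma entry_perm_rinf:
  assumes "permutation \<sigma>"
  shows "entry (perm_rinf \<sigma>) i j = (if i = \<sigma> j then 1 else 0)"
proof -
  obtain N where "\<forall>n\<in>{x. \<sigma> x \<noteq> x}. n < N"
    using permutation_finite_support[OF assms] finite_nat_set_iff_bounded by blast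
  then have N: "\<forall>n\<ge>N. \<sigma> n = n" by force
  have "inj \<sigma>"
    using permutation_bijective[OF assms] by (rule bij_is_inj)
  with N have "(\<lambda>i j. if i = \<sigma> j then 1 else 0) \<in> {r :: nat \<Rightarrow> nat \<Rightarrow> int.
    (\<forall>i j. r i j \<in> {0, 1}) \<and>
    (\<forall>i. \<exists>\<^sub>\<le>\<^sub>1 j. r i j = 1) \<and>
    (\<forall>j. \<exists>\<^sub>\<le>\<^sub>1 i. r i j = 1) \<and>
    (\<exists>N. \<forall>n\<ge>N. r n n = 1)}"
    by (auto simp: Uniq_def inj_eq intro!: exI[of _ N] split: if_splits)
  then show ?thesis
    unfolding perm_rinf_def by (simp add: Abs_rinf_inverse)
qed

text \<open>
  Cycles of length one are the identity permutation and are allowed, so that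
  \<open>eps {n}\<close> is a quasicycle.
\<close>

definition quasicycle :: "rinf \<Rightarrow> bool" where
  "quasicycle q \<longleftrightarrow> (\<exists>ns A. ns \<noteq> [] \<and> cycle ns \<and> A \<subseteq> set ns \<and>
     q = perm_rinf (cycle_of_list ns) * eps A)"

definition pairwise_independent :: "rinf list \<Rightarrow> bool" where
  "pairwise_independent qs \<longleftrightarrow>
     (\<forall>i<length qs. \<forall>j<length qs. i \<noteq> j \<longrightarrow> supp (qs ! i) \<inter> supp (qs ! j) = {})"


section \<open>Indecomposable finite characters\<close>

definition central :: "(rinf \<Rightarrow> complex) \<Rightarrow> bool" where
  "central f \<longleftrightarrow> (\<forall>r s. f (r * s) = f (s * r))"

text \<open>The \<open>n \<times> n\<close> matrix with entries \<open>a i j\<close>, where \<open>i, j < n\<close>.\<close>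

definition hermitian :: "nat \<Rightarrow> (nat \<Rightarrow> nat \<Rightarrow> complex) \<Rightarrow> bool" where
  "hermitian n a \<longleftrightarrow> (\<forall>i<n. \<forall>j<n. a i j = cnj (a j i))"

definition nonneg_definite :: "nat \<Rightarrow> (nat \<Rightarrow> nat \<Rightarrow> complex) \<Rightarrow> bool" where
  "nonneg_definite n a \<longleftrightarrow>
     (\<forall>x :: nat \<Rightarrow> complex. (\<Sum>i<n. \<Sum>j<n. cnj (x i) * a i j * x j) \<in> \<real>\<^sub>\<ge>\<^sub>0)"

definition positive_definite :: "(rinf \<Rightarrow> complex) \<Rightarrow> bool" where
  "positive_definite f \<longleftrightarrow> (\<forall>n. \<forall>r :: nat \<Rightarrow> rinf.
     hermitian n (\<lambda>i j. f (star (r i) * r j)) \<and>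
     nonneg_definite n (\<lambda>i j. f (star (r i) * r j)))"

definition linearly_independent_pair :: "(rinf \<Rightarrow> complex) \<Rightarrow> (rinf \<Rightarrow> complex) \<Rightarrow> bool" where
  "linearly_independent_pair g h \<longleftrightarrow>
     (\<forall>a b :: complex. (\<forall>r. a * g r + b * h r = 0) \<longrightarrow> a = 0 \<and> b = 0)"

definition indecomposable :: "(rinf \<Rightarrow> complex) \<Rightarrow> bool" where
  "indecomposable f \<longleftrightarrow> \<not> (\<exists>g h. central g \<and> positive_definite g \<and>
     central h \<and> positive_definite h \<and> linearly_independent_pair g h \<and> f = (\<lambda>r. g r + h r))"

definition indecomposable_finite_character :: "(rinf \<Rightarrow> complex) \<Rightarrow> bool" where
  "indecomposable_finite_character f \<longleftrightarrow>
     central f \<and> positive_definite f \<and> indecomposable f \<and> f 1 = 1"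

end

theory Submission
  imports Defs
begin

text \<open>
  It suffices to show \<open>f (s * r) = f s * f r\<close> whenever \<open>r\<close> and \<open>s\<close> have disjoint supports. By
  centrality, \<open>f (s * r')\<close> is the same for all conjugates \<open>r'\<close> of \<open>r\<close> whose support avoids that
  of \<open>s\<close>; so it extends to a function \<open>G r s\<close> of arbitrary \<open>s\<close>. As \<open>r'\<close> may be taken far away
  from any finite set, it commutes with everything in sight, hence \<open>G r\<close> is central, and for
  every \<open>c\<close> the function \<open>g\<^sub>c s = f (s * (1 + c r')\<^sup>* (1 + c r'))\<close> is central and positive
  definite. For \<open>|c| = 1\<close> the sum \<open>g\<^sub>c + g\<^sub>-\<^sub>c + 2 (f - G (r\<^sup>* r))\<close> equals \<open>4 f\<close>, and \<open>f - G (r\<^sup>* r)\<close> is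
  positive definite because \<open>r\<^sup>* r\<close> is a projection. Indecomposability makes \<open>g\<^sub>c\<close> proportional
  to \<open>f\<close>, and polarization over \<open>c\<close> does the same for \<open>G r\<close>.
\<close>

section \<open>Elements as partial injections\<close>

text \<open>With matrices read as relations, products become \<open>O\<close> and
  \<open>star\<close> becomes converse, so identities in the semigroup reduce to relation
  algebra.\<close>

definition graph :: "rinf \<Rightarrow> nat rel" where
  "graph r = {(i, j). entry r i j = 1}"

lemma entry_01: "entry r i j \<in> {0, 1}"
  using entry[of r] by blast

lemma graph_eqI:
  assumes "graph r = graph s"
  shows "r = s"
proof -
  have "entry r i j = entry s i j" for i j
    using assms entry_01[of r i j] entry_01[of s i j] unfolding graph_def set_eq_iff by force
  then show ?thesis by (intro entry_inject[THEN iffD1] ext)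
qed

lemma graph_one: "graph 1 = Id"
  by (auto simp: graph_def one_rinf.rep_eq split: if_splits)

lemma graph_mult: "graph (r * s) = graph r O graph s"
  using mat_mult_eq_1[of "entry r" "entry s"] entry[of r]
  by (auto simp: graph_def times_rinf.rep_eq relcomp_unfold)

lemma graph_star: "graph (star r) = (graph r)\<inverse>"
  by (auto simp: graph_def star.rep_eq)

lemma graph_perm_rinf: "permutation \<sigma> \<Longrightarrow> graph (perm_rinf \<sigma>) = {(\<sigma> j, j) |j. True}"
  by (auto simp: graph_def entry_perm_rinf split: if_splits)

lemma graph_right_unique: "(i, j) \<in> graph r \<Longrightarrow> (i, k) \<in> graph r \<Longrightarrow> j = k"
  using entry[of r] unfolding graph_def Uniq_def by blast

lemma graph_left_unique: "(i, k) \<in> graph r \<Longrightarrow> (j, k) \<in> graph r \<Longrightarrow> i = j"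
  using entry[of r] unfolding graph_def Uniq_def by blast

lemma supp_iff: "n \<in> supp r \<longleftrightarrow> (n, n) \<notin> graph r"
  by (simp add: supp_def graph_def)

lemma finite_supp: "finite (supp r)"
proof -
  obtain N where "\<forall>n\<ge>N. entry r n n = 1"
    using entry[of r] by blast
  then have "supp r \<subseteq> {..<N}"
    unfolding supp_def using not_le by auto
  then show ?thesis by (rule finite_subset) simp
qed

lemma supp_one [simp]: "supp 1 = {}"
  by (auto simp: supp_iff graph_one)

lemma supp_mult: "supp (r * s) \<subseteq> supp r \<union> supp s"
  by (auto simp: supp_iff graph_mult)

lemma supp_star [simp]: "supp (star r) = supp r"
  by (auto simp: supp_iff graph_star)

lemma star_star [simp]: "star (star r) = r"
  by (rule graph_eqI) (simp add: graph_star)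

lemma star_one [simp]: "star 1 = 1"
  by (rule graph_eqI) (simp add: graph_star graph_one)

lemma star_mult: "star (r * s) = star s * star r"
  by (rule graph_eqI) (simp add: graph_star graph_mult converse_relcomp)

text \<open>Since \<open>r\<close> is a partial injection, \<open>star r * r\<close> is the identity
  restricted to the columns in which \<open>r\<close> has an entry 1, hence a projection.\<close>

lemma star_mult_self_idem: "star r * r * (star r * r) = star r * r"
proof (rule graph_eqI)
  show "graph (star r * r * (star r * r)) = graph (star r * r)"
    unfolding graph_mult graph_star
    using graph_left_unique[of _ _ r] graph_right_unique[of _ _ r] by fast
qed

text \<open>The relation \<open>graph s\<close> fixes every point of \<open>supp r\<close>, while
  \<open>graph r\<close> never links a point of \<open>supp r\<close> with one outside. Exchanging
  \<open>r\<close> and \<open>s\<close> gives the reverse inclusion.\<close>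

lemma graph_relcomp_disjoint:
  assumes "supp r \<inter> supp s = {}"
  shows "graph r O graph s \<subseteq> graph s O graph r"
proof clarify
  fix i k j
  assume rik: "(i, k) \<in> graph r" and skj: "(k, j) \<in> graph s"
  have fix_s: "n \<in> supp r \<Longrightarrow> (n, n) \<in> graph s" for n
    using assms by (auto simp: supp_iff)
  show "(i, j) \<in> graph s O graph r"
  proof (cases "k \<in> supp r")
    case True
    then have "j = k" using fix_s skj graph_right_unique by blast
    moreover have "i \<in> supp r"
      using True rik graph_right_unique unfolding supp_iff by blast
    ultimately show ?thesis using fix_s rik by blast
  next
    case False
    then have "i = k" using rik graph_left_unique unfolding supp_iff by blast
    moreover have "j \<notin> supp r"
      using False fix_s skj graph_left_unique by metis
    ultimately show ?thesis using skj by (auto simp: supp_iff)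
  qed
qed

lemma mult_commute_disjoint:
  assumes "supp r \<inter> supp s = {}"
  shows "r * s = s * r"
proof (rule graph_eqI)
  show "graph (r * s) = graph (s * r)"
    using graph_relcomp_disjoint[of r s] graph_relcomp_disjoint[of s r] assms
    by (auto simp: graph_mult Int_commute)
qed


section \<open>Conjugation by permutations\<close>

lemma perm_rinf_star_mult:
  assumes "permutation \<sigma>"
  shows "star (perm_rinf \<sigma>) * perm_rinf \<sigma> = 1"
  using bij_is_inj[OF permutation_bijective[OF assms]]
  by (intro graph_eqI) (auto simp: graph_mult graph_star graph_one graph_perm_rinf assms inj_eq)

lemma perm_rinf_mult_star:
  assumes "permutation \<sigma>"
  shows "perm_rinf \<sigma> * star (perm_rinf \<sigma>) = 1"
  using bij_is_surj[OF permutation_bijective[OF assms]]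
  by (intro graph_eqI) (auto simp: graph_mult graph_star graph_one graph_perm_rinf assms relcomp_unfold dest: surjD)

lemma perm_rinf_comp:
  assumes "permutation \<sigma>" "permutation \<tau>"
  shows "perm_rinf (\<sigma> \<circ> \<tau>) = perm_rinf \<sigma> * perm_rinf \<tau>"
  using permutation_compose[OF assms(1,2)]
  by (intro graph_eqI) (auto simp: graph_mult graph_perm_rinf assms)

lemma supp_perm_rinf: "permutation \<sigma> \<Longrightarrow> supp (perm_rinf \<sigma>) = {n. \<sigma> n \<noteq> n}"
  by (auto simp: supp_iff graph_perm_rinf)

definition conjugate :: "(nat \<Rightarrow> nat) \<Rightarrow> rinf \<Rightarrow> rinf" where
  "conjugate \<sigma> r = perm_rinf \<sigma> * r * star (perm_rinf \<sigma>)"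

lemma conjugate_comp:
  "permutation \<sigma> \<Longrightarrow> permutation \<tau> \<Longrightarrow> conjugate (\<sigma> \<circ> \<tau>) r = conjugate \<sigma> (conjugate \<tau> r)"
  by (simp add: conjugate_def perm_rinf_comp star_mult mult.assoc)

lemma star_conjugate: "star (conjugate \<sigma> r) = conjugate \<sigma> (star r)"
  by (simp add: conjugate_def star_mult mult.assoc)

lemma conjugate_mult:
  assumes "permutation \<sigma>"
  shows "conjugate \<sigma> (r * s) = conjugate \<sigma> r * conjugate \<sigma> s"
proof -
  have "conjugate \<sigma> r * conjugate \<sigma> s
      = perm_rinf \<sigma> * r * (star (perm_rinf \<sigma>) * perm_rinf \<sigma>) * s * star (perm_rinf \<sigma>)"
    by (simp only: conjugate_def mult.assoc)
  then show ?thesis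
    by (simp add: perm_rinf_star_mult assms conjugate_def mult.assoc)
qed

lemma conjugate_fixed:
  assumes "permutation \<sigma>" "\<And>n. n \<in> supp r \<Longrightarrow> \<sigma> n = n"
  shows "conjugate \<sigma> r = r"
proof -
  have "perm_rinf \<sigma> * r = r * perm_rinf \<sigma>"
    using assms by (intro mult_commute_disjoint) (auto simp: supp_perm_rinf)
  then show ?thesis
    by (simp add: conjugate_def mult.assoc perm_rinf_mult_star assms(1))
qed

lemma supp_conjugate:
  assumes "permutation \<sigma>"
  shows "supp (conjugate \<sigma> r) = \<sigma> ` supp r"
proof -
  have bij: "bij \<sigma>" using assms by (rule permutation_bijective)
  have "(\<sigma> n, \<sigma> n) \<in> graph (conjugate \<sigma> r) \<longleftrightarrow> (n, n) \<in> graph r" for n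
    using bij_is_inj[OF bij]
    by (auto simp: conjugate_def graph_mult graph_star graph_perm_rinf assms relcomp_unfold inj_eq)
  then have "\<sigma> n \<in> supp (conjugate \<sigma> r) \<longleftrightarrow> \<sigma> n \<in> \<sigma> ` supp r" for n
    using bij_is_inj[OF bij] by (auto simp: supp_iff inj_eq)
  then show ?thesis
    using bij_is_surj[OF bij] by (metis subsetI subset_antisym surjD)
qed

text \<open>\<open>A\<close> and \<open>B\<close> have equally many elements, hence so do their
  complements in \<open>A \<union> B\<close>; any bijection between these completes
  \<open>h\<close>.\<close>

lemma extend_bij_to_permutation:
  assumes "finite A" "bij_betw h A B"
  obtains p where "p permutes A \<union> B" "\<And>x. x \<in> A \<Longrightarrow> p x = h x"
proof -
  have B: "finite B" using assms bij_betw_finite by blast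
  have "card (A \<union> B - A) = card (A \<union> B - B)"
    using assms B bij_betw_same_card[OF assms(2)] by (simp add: card_Diff_subset)
  then obtain k where k: "bij_betw k (A \<union> B - A) (A \<union> B - B)"
    using assms(1) B by (metis finite_Diff finite_UnI finite_same_card_bij)
  define p where "p x = (if x \<in> A then h x else if x \<in> B then k x else x)" for x
  have "bij_betw p A B"
    using assms(2) by (simp add: p_def cong: bij_betw_cong)
  moreover have "bij_betw p (A \<union> B - A) (A \<union> B - B)"
    using k by (rule bij_betw_cong[THEN iffD1, rotated]) (auto simp: p_def)
  ultimately have "bij_betw p (A \<union> (A \<union> B - A)) (B \<union> (A \<union> B - B))"
    by (rule bij_betw_combine) auto
  then have "bij_betw p (A \<union> B) (A \<union> B)"
    by (simp add: Un_absorb1 Un_commute)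
  then have "p permutes A \<union> B"
    by (rule bij_imp_permutes) (simp add: p_def)
  then show ?thesis by (rule that) (simp add: p_def)
qed

lemma displacing_permutation_exists:
  fixes S T :: "nat set"
  assumes "finite S" "finite T"
  obtains \<tau> where "permutation \<tau>" "\<tau> ` S \<inter> T = {}"
proof -
  obtain N where N: "\<forall>n\<in>T. n < N"
    using assms(2) finite_nat_set_iff_bounded by blast
  \<comment> \<open>Translation by \<open>N\<close> pushes \<open>S\<close> above all of
    \<open>T\<close>; only its restriction to \<open>S\<close> is kept, so that the extension has
    finite support.\<close>
  have "bij_betw ((+) N) S ((+) N ` S)"
    by (simp add: bij_betw_def)
  from extend_bij_to_permutation[OF assms(1) this]
  obtain p where p: "p permutes S \<union> (+) N ` S" "\<And>x. x \<in> S \<Longrightarrow> p x = N + x"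
    by blast
  have "permutation p"
    unfolding permutation_permutes using p(1) assms(1) by (intro exI conjI) simp_all
  moreover have "p ` S \<inter> T = {}"
    using p(2) N by force
  ultimately show ?thesis by (rule that)
qed

lemma central_conjugate:
  assumes "central f" "permutation \<sigma>"
  shows "f (conjugate \<sigma> r) = f r"
proof -
  have "f (conjugate \<sigma> r) = f (star (perm_rinf \<sigma>) * (perm_rinf \<sigma> * r))"
    using assms(1) by (simp add: central_def conjugate_def)
  then show ?thesis
    by (simp add: mult.assoc[symmetric] perm_rinf_star_mult assms(2))
qed

text \<open>A permutation that takes one copy of \<open>r\<close> to the other can be chosen to move
  only points of the supports of these copies. It then fixes \<open>s\<close>, and conjugation by it
  does not change \<open>f\<close>.\<close>

lemma central_mult_conjugate:
  assumes f: "central f"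
    and \<tau>: "permutation \<tau>" "\<tau> ` supp r \<inter> supp s = {}"
    and \<sigma>: "permutation \<sigma>" "\<sigma> ` supp r \<inter> supp s = {}"
  shows "f (s * conjugate \<tau> r) = f (s * conjugate \<sigma> r)"
proof -
  have bij: "bij \<tau>" "bij \<sigma>" using \<tau> \<sigma> by (auto intro: permutation_bijective)
  define h where "h = \<sigma> \<circ> inv \<tau>"
  have h: "h (\<tau> x) = \<sigma> x" for x
    using bij by (simp add: h_def bij_is_inj)
  have "bij_betw h (\<tau> ` supp r) (\<sigma> ` supp r)"
  proof (rule bij_betw_imageI)
    have "bij h"
      unfolding h_def using bij by (intro bij_comp bij_imp_bij_inv)
    then show "inj_on h (\<tau> ` supp r)"
      using bij_is_inj inj_on_subset by blast
    show "h ` \<tau> ` supp r = \<sigma> ` supp r"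
      by (simp add: image_image h)
  qed
  from extend_bij_to_permutation[OF _ this]
  obtain p where p: "p permutes \<tau> ` supp r \<union> \<sigma> ` supp r"
    and ph: "\<And>x. x \<in> \<tau> ` supp r \<Longrightarrow> p x = h x"
    using finite_supp by blast
  have perm: "permutation p"
    unfolding permutation_permutes using p finite_supp by (intro exI conjI) simp_all
  have ps: "conjugate p s = s"
    using permutes_not_in[OF p] \<tau> \<sigma> by (intro conjugate_fixed[OF perm]) blast
  \<comment> \<open>On \<open>supp r\<close> the maps \<open>p \<circ> \<tau>\<close> and \<sigma>
    agree, so the discrepancy \<rho> fixes \<open>supp r\<close> pointwise and conjugation by it
    leaves \<open>r\<close> unchanged.\<close>
  define \<rho> where "\<rho> = inv \<sigma> \<circ> (p \<circ> \<tau>)"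
  have \<rho>: "permutation \<rho>"
    unfolding \<rho>_def using \<tau> \<sigma> perm by (intro permutation_compose permutation_inverse)
  have "conjugate \<rho> r = r"
    using bij by (intro conjugate_fixed[OF \<rho>]) (simp add: \<rho>_def ph h bij_is_inj)
  moreover have "p \<circ> \<tau> = \<sigma> \<circ> \<rho>"
    using bij by (auto simp: \<rho>_def bij_is_surj surj_f_inv_f)
  ultimately have "conjugate p (conjugate \<tau> r) = conjugate \<sigma> r"
    using perm \<tau> \<sigma> \<rho> by (metis conjugate_comp)
  then have "conjugate p (s * conjugate \<tau> r) = s * conjugate \<sigma> r"
    using perm ps by (simp add: conjugate_mult)
  then show ?thesis
    using central_conjugate[OF f perm] by metis
qed


section \<open>The cone of positive definite functions\<close>

lemma positive_definite_star:
  assumes "positive_definite f"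
  shows "f (star r) = cnj (f r)"
proof -
  \<comment> \<open>The Hermitian condition for the pair \<open>r\<close>, 1 compares
    \<open>f (star r)\<close> with \<open>f r\<close> off the diagonal.\<close>
  define t where "t i = (if i = 0 then r else 1)" for i :: nat
  have herm: "hermitian 2 (\<lambda>i j. f (star (t i) * t j))"
    using assms unfolding positive_definite_def by blast
  have "f (star (t 0) * t 1) = cnj (f (star (t 1) * t 0))"
    by (rule herm[unfolded hermitian_def, rule_format]) simp_all
  then show ?thesis by (simp add: t_def)
qed

text \<open>Arbitrary finite index sets are allowed because a family indexed by pairs is needed
  later.\<close>

lemma positive_definite_sum:
  assumes "positive_definite f" "finite I"
  shows "(\<Sum>i\<in>I. \<Sum>j\<in>I. cnj (x i) * f (star (r i) * r j) * x j) \<in> \<real>\<^sub>\<ge>\<^sub>0"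
proof -
  obtain e where e: "bij_betw e {..<card I} I"
    using assms(2) ex_bij_betw_nat_finite lessThan_atLeast0 by metis
  have "(\<Sum>i<card I. \<Sum>j<card I. cnj (x (e i)) * f (star (r (e i)) * r (e j)) * x (e j)) \<in> \<real>\<^sub>\<ge>\<^sub>0"
    using assms(1) unfolding positive_definite_def nonneg_definite_def
    by (elim allE[of _ "card I"] allE[of _ "r \<circ> e"] conjE allE[of _ "x \<circ> e"]) simp
  then show ?thesis
    by (simp add: sum.reindex_bij_betw[OF e, symmetric])
qed

text \<open>Applying \<open>star\<close> to \<open>star (r i) * r j\<close> swaps \<open>i\<close>
  and \<open>j\<close>, so the Hermitian condition for families reduces to one on single
  elements.\<close>

lemma positive_definiteI:
  assumes "\<And>r. f (star r) = cnj (f r)"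
    and "\<And>(n::nat) r x. (\<Sum>i<n. \<Sum>j<n. cnj (x i) * f (star (r i) * r j) * x j) \<in> \<real>\<^sub>\<ge>\<^sub>0"
  shows "positive_definite f"
  unfolding positive_definite_def hermitian_def nonneg_definite_def
  by (intro allI impI conjI assms(2)) (simp add: assms(1)[symmetric] star_mult)

lemma positive_definite_add:
  assumes "positive_definite f" "positive_definite g"
  shows "positive_definite (\<lambda>r. f r + g r)"
proof (rule positive_definiteI)
  show "f (star r) + g (star r) = cnj (f r + g r)" for r
    using assms by (simp add: positive_definite_star)
  fix n and r :: "nat \<Rightarrow> rinf" and x :: "nat \<Rightarrow> complex"
  show "(\<Sum>i<n. \<Sum>j<n. cnj (x i) * (f (star (r i) * r j) + g (star (r i) * r j)) * x j) \<in> \<real>\<^sub>\<ge>\<^sub>0"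
    using nonneg_Reals_add_I[OF positive_definite_sum[OF assms(1), of "{..<n}" x r]
        positive_definite_sum[OF assms(2), of "{..<n}" x r]]
    by (simp add: sum.distrib algebra_simps)
qed

lemma positive_definite_scale:
  assumes "positive_definite f" "c \<ge> 0"
  shows "positive_definite (\<lambda>r. complex_of_real c * f r)"
proof (rule positive_definiteI)
  show "c * f (star r) = cnj (c * f r)" for r
    using assms by (simp add: positive_definite_star)
  fix n and r :: "nat \<Rightarrow> rinf" and x :: "nat \<Rightarrow> complex"
  have "complex_of_real c \<in> \<real>\<^sub>\<ge>\<^sub>0"
    using assms(2) by simp
  from nonneg_Reals_mult_I[OF this positive_definite_sum[OF assms(1), of "{..<n}" x r]]
  show "(\<Sum>i<n. \<Sum>j<n. cnj (x i) * (c * f (star (r i) * r j)) * x j) \<in> \<real>\<^sub>\<ge>\<^sub>0"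
    by (simp add: sum_distrib_left algebra_simps)
qed

lemma central_add: "central f \<Longrightarrow> central g \<Longrightarrow> central (\<lambda>r. f r + g r)"
  by (simp add: central_def)

lemma central_scale: "central f \<Longrightarrow> central (\<lambda>r. c * f r)"
  by (simp add: central_def)

text \<open>Indecomposability says that \<open>f\<close> spans an extreme ray of the cone of central
  positive definite functions: a summand of a multiple of \<open>f\<close> is proportional to
  \<open>f\<close>. Evaluation at 1 gives the factor.\<close>

lemma indecomposable_dominated:
  assumes f: "indecomposable f" "f 1 = 1"
    and "central g" "positive_definite g" "central h" "positive_definite h"
    and "C > 0" and sum: "\<And>r. g r + h r = complex_of_real C * f r"
  shows "g r = g 1 * f r"
proof -
  let ?g = "\<lambda>r. complex_of_real (1 / C) * g r" and ?h = "\<lambda>r. complex_of_real (1 / C) * h r"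
  have C: "complex_of_real C \<noteq> 0" using \<open>C > 0\<close> by simp
  have "central ?g" "central ?h"
    using assms by (simp_all only: central_scale)
  moreover have "positive_definite ?g" "positive_definite ?h"
    using assms by (simp_all only: positive_definite_scale divide_nonneg_pos zero_le_one)
  moreover have "f = (\<lambda>r. ?g r + ?h r)"
    using sum C by (simp add: add_divide_distrib[symmetric])
  ultimately have "\<not> linearly_independent_pair ?g ?h"
    using f(1) unfolding indecomposable_def by blast
  then obtain a b where ab: "a \<noteq> 0 \<or> b \<noteq> 0" and "\<And>r. a * ?g r + b * ?h r = 0"
    unfolding linearly_independent_pair_def by blast
  then have "a * g r + b * h r = 0" for r
    using C by (simp add: field_simps)
  then have "a * g r + b * (C * f r - g r) = 0" for r
    by (metis sum add_diff_cancel_left')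
  then have eq: "(b - a) * g r = b * C * f r" for r
    by (simp add: algebra_simps)
  \<comment> \<open>If \<open>a = b\<close>, then \<open>eq\<close> at 1 gives
    \<open>b * C = 0\<close>, so both coefficients vanish, against \<open>ab\<close>.\<close>
  have "b \<noteq> a"
    using eq[of 1] ab C f(2) by auto
  have "(b - a) * g r = (b - a) * g 1 * f r"
    using eq[of r] eq[of 1] f(2) by simp
  with \<open>b \<noteq> a\<close> show ?thesis by simp
qed


section \<open>Multiplying by a far away copy\<close>

text \<open>This is \<open>G r s\<close>. The permutation depends on \<open>s\<close>, but for
  central \<open>f\<close> the value does not depend on the choice.\<close>

definition displaced :: "(rinf \<Rightarrow> complex) \<Rightarrow> rinf \<Rightarrow> rinf \<Rightarrow> complex" where
  "displaced f r s =
     f (s * conjugate (SOME \<tau>. permutation \<tau> \<and> \<tau> ` supp r \<inter> supp s = {}) r)"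

lemma displaced_eq:
  assumes "central f" "permutation \<tau>" "\<tau> ` supp r \<inter> supp s = {}"
  shows "displaced f r s = f (s * conjugate \<tau> r)"
proof -
  have "\<exists>\<tau>. permutation \<tau> \<and> \<tau> ` supp r \<inter> supp s = {}"
    using assms by blast
  from someI_ex[OF this] show ?thesis
    unfolding displaced_def using assms by (intro central_mult_conjugate) auto
qed

lemma displaced_disjoint:
  assumes "central f" "supp r \<inter> supp s = {}"
  shows "displaced f r s = f (s * r)"
proof -
  have "permutation (id :: nat \<Rightarrow> nat)" by (rule permutation_id)
  moreover from this have "conjugate id r = r" by (rule conjugate_fixed) simp
  ultimately show ?thesis
    using displaced_eq[of f id r s] assms by simp
qed

lemma central_displaced:
  assumes "central f"
  shows "central (displaced f r)"
  unfolding central_def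
proof (intro allI)
  fix s t
  \<comment> \<open>A single copy of \<open>r\<close> away from both supports serves
    \<open>s * t\<close> and \<open>t * s\<close> alike, and commutes with both factors.\<close>
  obtain \<tau> where \<tau>: "permutation \<tau>" "\<tau> ` supp r \<inter> (supp s \<union> supp t) = {}"
    using displacing_permutation_exists[of "supp r" "supp s \<union> supp t"] finite_supp by blast
  let ?r = "conjugate \<tau> r"
  have "displaced f r (s * t) = f (s * (t * ?r))"
    using \<tau> supp_mult[of s t] assms by (subst displaced_eq[where \<tau> = \<tau>]) (auto simp: mult.assoc)
  also have "t * ?r = ?r * t"
    using \<tau> by (intro mult_commute_disjoint) (auto simp: supp_conjugate)
  also have "f (s * (?r * t)) = f (t * (s * ?r))"
    using assms by (simp add: central_def mult.assoc[symmetric])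
  also have "\<dots> = displaced f r (t * s)"
    using \<tau> supp_mult[of t s] assms by (subst displaced_eq[where \<tau> = \<tau>]) (auto simp: mult.assoc)
  finally show "displaced f r (s * t) = displaced f r (t * s)" .
qed

lemma displaced_star:
  assumes "central f" "positive_definite f"
  shows "displaced f (star r) (star s) = cnj (displaced f r s)"
proof -
  obtain \<tau> where \<tau>: "permutation \<tau>" "\<tau> ` supp r \<inter> supp s = {}"
    using displacing_permutation_exists[of "supp r" "supp s"] finite_supp by blast
  let ?r = "conjugate \<tau> r"
  have "displaced f (star r) (star s) = f (star s * star ?r)"
    using \<tau> assms by (simp add: displaced_eq star_conjugate)
  also have "\<dots> = f (star (s * ?r))"
    using assms(1) by (simp add: central_def star_mult)
  also have "\<dots> = cnj (displaced f r s)"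
    using \<tau> assms by (simp add: positive_definite_star displaced_eq)
  finally show ?thesis .
qed

text \<open>With \<open>r'\<close> a far away copy of \<open>r\<close>, this is \<open>f (s * (1 + c r')\<^sup>* (1 + c r'))\<close>, expanded.\<close>

definition perturbed :: "(rinf \<Rightarrow> complex) \<Rightarrow> complex \<Rightarrow> rinf \<Rightarrow> rinf \<Rightarrow> complex" where
  "perturbed f c r s = f s + c * displaced f r s + cnj c * displaced f (star r) s
     + cnj c * c * displaced f (star r * r) s"

lemma central_perturbed: "central f \<Longrightarrow> central (perturbed f c r)"
  using central_displaced[of f] unfolding central_def perturbed_def by metis

text \<open>The quadratic form of \<open>perturbed f c r\<close> at the \<open>s i\<close> is that
  of \<open>f\<close> at a family twice as long, made of the \<open>s i\<close> and the
  \<open>s i * R\<close>, where one copy \<open>R\<close> of \<open>r\<close> avoids all the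
  \<open>s i\<close>.\<close>

lemma positive_definite_perturbed:
  assumes "central f" "positive_definite f"
  shows "positive_definite (perturbed f c r)"
proof (rule positive_definiteI)
  fix s
  have "displaced f r (star s) = cnj (displaced f (star r) s)"
    and "displaced f (star r * r) (star s) = cnj (displaced f (star r * r) s)"
    using displaced_star[OF assms, of "star r" s] displaced_star[OF assms, of "star r * r" s]
    by (simp_all add: star_mult)
  then show "perturbed f c r (star s) = cnj (perturbed f c r s)"
    using assms by (simp add: perturbed_def displaced_star positive_definite_star)
next
  fix n and s :: "nat \<Rightarrow> rinf" and x :: "nat \<Rightarrow> complex"
  let ?T = "\<Union>i<n. supp (s i)"
  obtain \<tau> where \<tau>: "permutation \<tau>" "\<tau> ` supp r \<inter> ?T = {}"
    using displacing_permutation_exists[of "supp r" ?T] finite_supp by blast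
  define R where "R = conjugate \<tau> r"
  have supp_R: "supp R \<inter> ?T = {}"
    using \<tau> by (simp add: R_def supp_conjugate)
  \<comment> \<open>The Boolean selects 1 or \<open>c R\<close> in the factor
    \<open>1 + c R\<close>; the four pairs of choices yield the four terms of
    \<open>perturbed\<close>.\<close>
  define t where "t = (\<lambda>(i, b). if b then s i * R else s i)"
  define y where "y = (\<lambda>(i, b). if b then c * x i else x i)"
  have "(\<Sum>b\<in>UNIV. \<Sum>b'\<in>UNIV. cnj (y (i, b)) * f (star (t (i, b)) * t (j, b')) * y (j, b'))
      = cnj (x i) * perturbed f c r (star (s i) * s j) * x j"
    if "i < n" "j < n" for i j
  proof -
    let ?s = "star (s i) * s j"
    have disj: "\<tau> ` supp r \<inter> supp ?s = {}"
      using supp_mult[of "star (s i)" "s j"] \<tau> that by auto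
    have "supp (star r * r) \<subseteq> supp r"
      using supp_mult[of "star r" r] by simp
    then have "\<tau> ` supp (star r * r) \<inter> supp ?s = {}"
      using disj by blast
    with disj have d: "displaced f r ?s = f (?s * R)" "displaced f (star r) ?s = f (?s * star R)"
      "displaced f (star r * r) ?s = f (?s * (star R * R))"
      using \<tau>(1) assms(1)
      by (simp_all add: displaced_eq[of f \<tau>] R_def star_conjugate conjugate_mult)
    have "f (star R * (star (s i) * s j)) = f (?s * star R)"
      using assms(1) by (simp add: central_def)
    \<comment> \<open>Here \<open>R\<close> is first commuted past \<open>?s\<close> to stand next
      to \<open>star R\<close>; centrality then moves both to the right.\<close>
    moreover have "f (star R * (star (s i) * (s j * R))) = f (?s * (star R * R))"
    proof -
      have "?s * R = R * ?s"
        using disj \<tau>(1) by (intro mult_commute_disjoint) (auto simp: R_def supp_conjugate)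
      then have "star (s i) * (s j * R) = R * ?s"
        by (simp add: mult.assoc)
      moreover have "f (star R * R * ?s) = f (?s * (star R * R))"
        using assms(1) by (simp add: central_def)
      ultimately show ?thesis
        by (simp add: mult.assoc)
    qed
    ultimately show ?thesis
      by (simp add: UNIV_bool t_def y_def perturbed_def d star_mult algebra_simps)
  qed
  then have "(\<Sum>i<n. \<Sum>j<n. cnj (x i) * perturbed f c r (star (s i) * s j) * x j)
     = (\<Sum>i<n. \<Sum>j<n. \<Sum>b\<in>UNIV. \<Sum>b'\<in>UNIV.
         cnj (y (i, b)) * f (star (t (i, b)) * t (j, b')) * y (j, b'))"
    by simp
  also have "\<dots> = (\<Sum>i<n. \<Sum>b\<in>UNIV. \<Sum>j<n. \<Sum>b'\<in>UNIV.
         cnj (y (i, b)) * f (star (t (i, b)) * t (j, b')) * y (j, b'))"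
    by (intro sum.cong refl sum.swap)
  also have "\<dots> = (\<Sum>p\<in>{..<n} \<times> UNIV. \<Sum>q\<in>{..<n} \<times> UNIV. cnj (y p) * f (star (t p) * t q) * y q)"
    by (simp only: sum.cartesian_product' split_beta prod.collapse)
  also have "\<dots> \<in> \<real>\<^sub>\<ge>\<^sub>0"
    using assms(2) by (rule positive_definite_sum) simp
  finally show "(\<Sum>i<n. \<Sum>j<n. cnj (x i) * perturbed f c r (star (s i) * s j) * x j) \<in> \<real>\<^sub>\<ge>\<^sub>0" .
qed


section \<open>Multiplicativity\<close>

lemma perturbed_proportional:
  assumes f: "central f" "positive_definite f" "indecomposable f" "f 1 = 1" and c: "cmod c = 1"
  shows "perturbed f c r s = perturbed f c r 1 * f s"
proof -
  let ?p = "star r * r"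
  \<comment> \<open>\<open>h\<close> is what is missing from \<open>4 * f\<close>: adding the
    function for \<open>- c\<close> cancels the terms linear in \<open>c\<close> and
    \<open>cnj c\<close>, and the second summand removes the remaining
    \<open>displaced f ?p\<close>.\<close>
  define h where "h s = perturbed f (- c) r s + complex_of_real 2 * perturbed f (- 1) ?p s" for s
  have "star ?p = ?p" by (simp add: star_mult)
  \<comment> \<open>As \<open>?p\<close> is a self-adjoint idempotent, \<open>1 - ?p\<close> equals
    \<open>(1 - ?p)\<close> starred times itself; this makes the difference positive
    definite.\<close>
  then have p: "perturbed f (- 1) ?p s = f s - displaced f ?p s" for s
    by (simp add: perturbed_def star_mult_self_idem)
  have "cnj c * c = 1"
    using c complex_norm_square[of c] by (simp add: mult.commute)
  then have "perturbed f c r s + h s = complex_of_real 4 * f s" for s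
    by (simp add: h_def p) (simp add: perturbed_def)
  moreover have "central h"
    unfolding h_def using f by (intro central_add central_scale central_perturbed)
  moreover have "positive_definite h"
    unfolding h_def using f
    by (intro positive_definite_add positive_definite_scale positive_definite_perturbed) auto
  ultimately show ?thesis
    using f by (intro indecomposable_dominated[where C = 4 and h = h]
        central_perturbed positive_definite_perturbed) auto
qed

text \<open>Weight \<open>perturbed f c r s\<close> by \<open>cnj c\<close> and sum over the fourth
  roots of unity \<open>c\<close>: the sums of \<open>cnj c\<close> and of its square vanish, so
  only the coefficient of \<open>c\<close> survives.\<close>

lemma displaced_polarization:
  "4 * displaced f r s = perturbed f 1 r s - perturbed f (- 1) r s
     - \<i> * perturbed f \<i> r s + \<i> * perturbed f (- \<i>) r s"
  by (simp add: perturbed_def algebra_simps)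

lemma indecomposable_mult_disjoint:
  assumes "indecomposable_finite_character f" "supp r \<inter> supp s = {}"
  shows "f (r * s) = f r * f s"
proof -
  have f: "central f" "positive_definite f" "indecomposable f" "f 1 = 1"
    using assms(1) by (auto simp: indecomposable_finite_character_def)
  note proportional = perturbed_proportional[OF f, of _ r s]
  \<comment> \<open>All four functions in the polarization are multiples of \<open>f\<close> by
    their values at 1, so the same holds for \<open>displaced f r\<close>. Its value at 1 is
    \<open>f r\<close>, because \<open>supp 1\<close> is empty.\<close>
  have "4 * displaced f r s = 4 * displaced f r 1 * f s"
    using proportional[of 1] proportional[of "- 1"] proportional[of \<i>] proportional[of "- \<i>"]
    unfolding displaced_polarization by (simp add: algebra_simps)
  then show ?thesis
    using f(1) assms(2) by (simp add: displaced_disjoint central_def)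
qed

lemma supp_prod_list: "supp (prod_list rs) \<subseteq> (\<Union>r\<in>set rs. supp r)"
proof (induction rs)
  case (Cons r rs)
  then show ?case
    using supp_mult[of r "prod_list rs"] by auto
qed simp

lemma pairwise_independent_Cons:
  assumes "pairwise_independent (q # qs)"
  shows "pairwise_independent qs" "\<And>q'. q' \<in> set qs \<Longrightarrow> supp q \<inter> supp q' = {}"
proof -
  have disj: "supp ((q # qs) ! i) \<inter> supp ((q # qs) ! j) = {}"
    if "i < length (q # qs)" "j < length (q # qs)" "i \<noteq> j" for i j
    using assms that unfolding pairwise_independent_def by blast
  have "supp (qs ! i) \<inter> supp (qs ! j) = {}"
    if "i < length qs" "j < length qs" "i \<noteq> j" for i j
    using disj[of "Suc i" "Suc j"] that by simp
  then show "pairwise_independent qs"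
    unfolding pairwise_independent_def by blast
  show "supp q \<inter> supp q' = {}" if "q' \<in> set qs" for q'
  proof -
    obtain i where "i < length qs" "q' = qs ! i"
      using \<open>q' \<in> set qs\<close> by (auto simp: in_set_conv_nth)
    then show ?thesis
      using disj[of 0 "Suc i"] by simp
  qed
qed

theorem theorem5:
  fixes f :: "rinf \<Rightarrow> complex" and r :: rinf and qs :: "rinf list"
  assumes "indecomposable_finite_character f"
    and "\<forall>q \<in> set qs. quasicycle q"
    and "pairwise_independent qs"
    and "r = prod_list qs"
  shows "f r = (\<Prod>q\<leftarrow>qs. f q)"
proof -
  have "f (prod_list qs) = (\<Prod>q\<leftarrow>qs. f q)"
    using assms(3)
  proof (induction qs)
    case Nil
    then show ?case
      using assms(1) by (simp add: indecomposable_finite_character_def)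
  next
    case (Cons q qs)
    note indep = pairwise_independent_Cons[OF Cons.prems]
    have "supp q \<inter> supp (prod_list qs) = {}"
      using indep(2) supp_prod_list[of qs] by blast
    then show ?case
      using Cons.IH[OF indep(1)] indecomposable_mult_disjoint[OF assms(1)] by simp
  qed
  then show ?thesis using assms(4) by simp
qed

end
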